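(* Let $k\ge3$ be an integer. If $1\le r\le n$ are integers, $\mathcal G\subseteq\binom{[n]}{r}$ is $k$-cosunflower-free and $|\mathcal G|=M$, then \[ f_k(N)\ge(\log N)^{\frac{r}{en}M^{1/r}-o(1)}\qquad (N\to\infty). \] Conversely, for every $\varepsilon>0$ there is a triple $(n,r,\mathcal G)$ with $1\le r\le n$ integers and $\mathcal G\subseteq\binom{[n]}{r}$ a $k$-cosunflower-free family for which \[ \frac{r}{en}|\mathcal G|^{1/r}>\gamma_k-\varepsilon. \]
   Context: Write $[N]=\{1,\dots,N\}$; $e$ is the base of the natural logarithm. A set $A\subseteq[N]$ is LCM-$k$-free if it contains no $k$ distinct integers $a_1,\dots,a_k$ for which $\operatorname{lcm}(a_i,a_j)$ is the same for all pairs $1\le i<j\le k$; $f_k(N):=\max\{\sum_{a\in A}1/a : A\subseteq[N]\text{ is LCM-}k\text{-free}\}$, and $\gamma_k:=\lim_{N\to\infty}\frac{\log f_k(N)}{\log\log N}$ (this limit exists for every $k\ge 3$). Distinct sets $S_1,\dots,S_k$ form a $k$-cosunflower if their pairwise unions are all equal; a family of sets is $k$-cosunflower-free if no $k$ distinct members form a $k$-cosunflower. $\binom{[n]}{r}$ is the family of all $r$-element subsets of $[n]$. *)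

theory Defs
  imports Complex_Main "HOL-Library.Landau_Symbols" "HOL-Library.Ramsey"
begin

text \<open>Both notions of freeness below quantify over sets \<open>F\<close> with \<open>k\<close> elements, which are the same
  as \<open>k\<close> distinct (unordered) elements.\<close>

definition lcm_free :: "nat \<Rightarrow> nat set \<Rightarrow> bool" where
  "lcm_free k A \<longleftrightarrow>
     \<not> (\<exists>F\<subseteq>A. finite F \<and> card F = k \<and> (\<exists>l. \<forall>a\<in>F. \<forall>b\<in>F. a \<noteq> b \<longrightarrow> lcm a b = l))"

definition lcm_max :: "nat \<Rightarrow> nat \<Rightarrow> real" where
  "lcm_max k N = Max {(\<Sum>a\<in>A. 1 / real a) | A. A \<subseteq> {1..N} \<and> lcm_free k A}"

text \<open>The limit exists for \<open>k \<ge> 3\<close>; \<^const>\<open>lim\<close> is unspecified where it does not.\<close>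

definition lcm_exponent :: "nat \<Rightarrow> real" where
  "lcm_exponent k = lim (\<lambda>N. ln (lcm_max k N) / ln (ln (real N)))"

definition cosunflower :: "'a set set \<Rightarrow> bool" where
  "cosunflower F \<longleftrightarrow> (\<exists>U. \<forall>S\<in>F. \<forall>T\<in>F. S \<noteq> T \<longrightarrow> S \<union> T = U)"

definition cosunflower_free :: "nat \<Rightarrow> 'a set set \<Rightarrow> bool" where
  "cosunflower_free k G \<longleftrightarrow> \<not> (\<exists>F\<subseteq>G. finite F \<and> card F = k \<and> cosunflower F)"

end

(*
  A squarefree integer is identified with its set of prime factors, and lcm with union, so LCM-k-free
  sets of squarefree integers are cosunflower-free families of sets of primes.  For uniform families
  and k >= 3, a family stays cosunflower-free when every point is blown up to a set of clones (each
  member being replaced by all its transversals), and when it is raised to a cartesian power.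

  Lower bound: with L = log log N, split the primes up to N^(1/(rt)) into nt classes of about equal
  mass sum 1/p = L/(nt), and let the transversals of the t-th power of G be the prime sets of A.  The
  reciprocal sum is about (M (L/(nt))^r)^t, which is largest for t = M^(1/r) L/(en), the value being
  exp(r M^(1/r) L/(en)).

  Upper bound: let S be the supremum of r/(en) |G|^(1/r).  Up to the factor sum 1/d^2 <= 2 one may take
  A to consist of squarefree integers.  Blowing up each prime p <= N to D/p points turns reciprocal
  sums into cardinalities, so the members with r prime factors contribute at most (e S sum 1/p / r)^r.
  The sum over r of these is at most C exp((1 + eta) S sum 1/p), and sum 1/p <= (1 + eta) log log N.

  Hence log f_k(N) / log log N converges to S, which gives the second claim.
*)
theory Submission
  imports Defs "HOL-Analysis.Harmonic_Numbers" "HOL-Computational_Algebra.Squarefree"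
    "HOL-Real_Asymp.Real_Asymp"
begin

section \<open>Cosunflower-free families\<close>

text \<open>Two equal members force \<open>U = T a\<close>, so every member lies in
  \<open>T a\<close> and, having the same size, equals it. Applied to projections of a cosunflower:
  they stay distinct or all collapse to one set.\<close>

lemma uniform_cosunflower_inj_or_const:
  fixes T :: "'i \<Rightarrow> 'a set"
  assumes fin: "\<And>i. i \<in> I \<Longrightarrow> finite (T i)" and card: "\<And>i. i \<in> I \<Longrightarrow> card (T i) = r"
    and un: "\<And>i j. i \<in> I \<Longrightarrow> j \<in> I \<Longrightarrow> i \<noteq> j \<Longrightarrow> T i \<union> T j = U"
  shows "inj_on T I \<or> (\<exists>S. \<forall>i\<in>I. T i = S)"
proof (cases "inj_on T I")
  case False
  then obtain a b where ab: "a \<in> I" "b \<in> I" "a \<noteq> b" "T a = T b"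
    by (auto simp: inj_on_def)
  have "T c = T a" if c: "c \<in> I" for c
  proof (cases "c = a")
    case False
    have "T c \<subseteq> T a"
      using un[OF ab(1-3)] un[OF c ab(1) False] ab(4) by blast
    then show ?thesis
      using card_subset_eq[OF fin[OF ab(1)]] card[OF c] card[OF ab(1)] by simp
  qed simp
  then show ?thesis by blast
qed simp

lemma cosunflower_freeD:
  assumes "cosunflower_free k \<G>" "finite I" "card I = k" "inj_on T I" "T ` I \<subseteq> \<G>"
    and "\<And>i j. i \<in> I \<Longrightarrow> j \<in> I \<Longrightarrow> i \<noteq> j \<Longrightarrow> T i \<union> T j = U"
  shows False
proof -
  have "cosunflower (T ` I)"
    unfolding cosunflower_def using assms(6) by (intro exI[of _ U]) auto
  moreover have "card (T ` I) = k"
    using assms by (simp add: card_image)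
  ultimately show False
    using assms(1,2,5) unfolding cosunflower_free_def by blast
qed

lemma cosunflower_freeI:
  assumes "\<And>H U. \<lbrakk>H \<subseteq> \<G>; finite H; card H = k;
    \<And>S T. S \<in> H \<Longrightarrow> T \<in> H \<Longrightarrow> S \<noteq> T \<Longrightarrow> S \<union> T = U\<rbrakk> \<Longrightarrow> False"
  shows "cosunflower_free k \<G>"
  unfolding cosunflower_free_def cosunflower_def using assms by metis

lemma cosunflower_free_subset:
  "cosunflower_free k \<G> \<Longrightarrow> \<H> \<subseteq> \<G> \<Longrightarrow> cosunflower_free k \<H>"
  unfolding cosunflower_free_def by blast

section \<open>Blowing up points to sets of clones\<close>

definition transversals :: "('b \<Rightarrow> 'a) \<Rightarrow> 'b set \<Rightarrow> 'a set \<Rightarrow> 'b set set" where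
  "transversals \<pi> X S = {T. T \<subseteq> X \<and> inj_on \<pi> T \<and> \<pi> ` T = S}"

text \<open>\<open>\<pi>\<close> sends a clone to the point it copies, so the clones of a point are
  its fibre in \<open>X\<close>.\<close>

definition blow_up :: "('b \<Rightarrow> 'a) \<Rightarrow> 'b set \<Rightarrow> 'a set set \<Rightarrow> 'b set set" where
  "blow_up \<pi> X \<F> = (\<Union>S\<in>\<F>. transversals \<pi> X S)"

lemma transversals_disjoint:
  "S \<noteq> S' \<Longrightarrow> transversals \<pi> X S \<inter> transversals \<pi> X S' = {}"
  by (auto simp: transversals_def)

text \<open>If \<open>x \<in> T1 - T2\<close>, then \<open>x \<in> T3\<close>, and the point of \<open>T2\<close> over \<open>\<pi> x\<close> lies in \<open>T1\<close> or \<open>T3\<close> as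
  well, which then is not a transversal.\<close>

lemma transversal_pairwise_union_subset:
  assumes T: "T1 \<in> transversals \<pi> X S" "T2 \<in> transversals \<pi> X S" "T3 \<in> transversals \<pi> X S"
    and U: "T1 \<union> T2 = U" "T1 \<union> T3 = U" "T2 \<union> T3 = U"
  shows "T1 \<subseteq> T2"
proof
  fix x assume x: "x \<in> T1"
  show "x \<in> T2"
  proof (rule ccontr)
    assume nx: "x \<notin> T2"
    then have x3: "x \<in> T3" using x U by blast
    have "\<pi> x \<in> \<pi> ` T2" using x T unfolding transversals_def by blast
    then obtain y where y: "y \<in> T2" "\<pi> y = \<pi> x" by auto
    then have "y \<in> T1 \<or> y \<in> T3" using U by blast
    then have "y = x"
      using x x3 y T unfolding transversals_def inj_on_def by blast
    then show False using y nx by simp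
  qed
qed

text \<open>By the dichotomy, the projections of a cosunflower either form a
  \<open>k\<close>-cosunflower in \<open>\<F>\<close> or are all the same \<open>S\<close>. In the
  second case three transversals of \<open>S\<close> with equal pairwise unions would coincide; this
  is where \<open>k \<ge> 3\<close> enters.\<close>

lemma blow_up_cosunflower_free:
  assumes k: "k \<ge> 3" and free: "cosunflower_free k \<F>" and fin: "finite X"
    and unif: "\<And>S. S \<in> \<F> \<Longrightarrow> card S = r"
  shows "cosunflower_free k (blow_up \<pi> X \<F>)"
proof (rule cosunflower_freeI)
  fix H U
  assume H: "H \<subseteq> blow_up \<pi> X \<F>" "finite H" "card H = k"
    and U: "\<And>S T. S \<in> H \<Longrightarrow> T \<in> H \<Longrightarrow> S \<noteq> T \<Longrightarrow> S \<union> T = U"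
  have tr: "T \<in> transversals \<pi> X (\<pi> ` T)" "\<pi> ` T \<in> \<F>" "finite T" if "T \<in> H" for T
    using that H(1) fin by (auto simp: blow_up_def transversals_def intro: finite_subset)
  have un: "\<pi> ` S \<union> \<pi> ` T = \<pi> ` U" if "S \<in> H" "T \<in> H" "S \<noteq> T" for S T
    using U[OF that] by blast
  have "inj_on (\<lambda>T. \<pi> ` T) H \<or> (\<exists>S. \<forall>T\<in>H. \<pi> ` T = S)"
  proof (rule uniform_cosunflower_inj_or_const)
    show "finite (\<pi> ` T)" if "T \<in> H" for T using tr(3)[OF that] by simp
    show "card (\<pi> ` T) = r" if "T \<in> H" for T using unif[OF tr(2)[OF that]] .
    show "\<pi> ` S \<union> \<pi> ` T = \<pi> ` U" if "S \<in> H" "T \<in> H" "S \<noteq> T" for S T using un[OF that] .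
  qed
  then show False
  proof
    assume "inj_on (\<lambda>T. \<pi> ` T) H"
    then show False
      by (rule cosunflower_freeD[OF free H(2,3) _ _ un]) (use tr(2) in auto)
  next
    assume "\<exists>S. \<forall>T\<in>H. \<pi> ` T = S"
    then obtain S where S: "T \<in> transversals \<pi> X S" if "T \<in> H" for T
      using tr(1) by metis
    have "card H \<ge> 3" using k H by simp
    then obtain H' where "H' \<subseteq> H" "card H' = 3"
      by (meson obtain_subset_with_card_n)
    then obtain T1 T2 T3 where T: "T1 \<in> H" "T2 \<in> H" "T3 \<in> H" "T1 \<noteq> T2" "T1 \<noteq> T3" "T2 \<noteq> T3"
      by (auto simp: card_3_iff)
    have "T1 \<subseteq> T2"
      by (rule transversal_pairwise_union_subset[OF S[OF T(1)] S[OF T(2)] S[OF T(3)]])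
        (use T U in auto)
    moreover have "T2 \<subseteq> T1"
      by (rule transversal_pairwise_union_subset[OF S[OF T(2)] S[OF T(1)] S[OF T(3)], of U])
        (use T U[OF T(2,1)] U[OF T(2,3)] U[OF T(1,3)] in auto)
    ultimately show False using T by blast
  qed
qed

lemma finite_transversals: "finite X \<Longrightarrow> finite (transversals \<pi> X S)"
  by (rule finite_subset[of _ "Pow X"]) (auto simp: transversals_def)

lemma blow_up_card:
  "T \<in> blow_up \<pi> X \<F> \<Longrightarrow> (\<And>S. S \<in> \<F> \<Longrightarrow> card S = r) \<Longrightarrow> card T = r"
  unfolding blow_up_def transversals_def by (auto dest: card_image)

lemma blow_up_subset: "T \<in> blow_up \<pi> X \<F> \<Longrightarrow> T \<subseteq> X"
  unfolding blow_up_def transversals_def by auto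

text \<open>Expanding the product of the fibre sums picks one clone per point. A choice function
  corresponds to its image and is recovered by inverting \<open>\<pi>\<close> on that
  transversal.\<close>

lemma sum_transversals:
  fixes w :: "'b \<Rightarrow> 'c :: comm_semiring_1"
  assumes X: "finite X" and S: "finite S"
  shows "(\<Sum>T\<in>transversals \<pi> X S. \<Prod>x\<in>T. w x) = (\<Prod>s\<in>S. \<Sum>x | x \<in> X \<and> \<pi> x = s. w x)"
proof -
  let ?B = "\<lambda>s. {x. x \<in> X \<and> \<pi> x = s}"
  have "(\<Prod>s\<in>S. \<Sum>x\<in>?B s. w x) = (\<Sum>g\<in>PiE S ?B. \<Prod>s\<in>S. w (g s))"
    using X S by (intro prod_sum_PiE) auto
  also have "\<dots> = (\<Sum>T\<in>transversals \<pi> X S. \<Prod>x\<in>T. w x)"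
  proof (rule sum.reindex_bij_witness[of _ "\<lambda>T. restrict (the_inv_into T \<pi>) S" "\<lambda>g. g ` S"])
    fix g assume g: "g \<in> PiE S ?B"
    then have gs: "\<And>s. s \<in> S \<Longrightarrow> g s \<in> X \<and> \<pi> (g s) = s" by auto
    then have inj: "inj_on g S" by (metis inj_onI)
    have injT: "inj_on \<pi> (g ` S)" using gs by (auto simp: inj_on_def)
    show "g ` S \<in> transversals \<pi> X S"
      using gs injT by (force simp: transversals_def)
    have "the_inv_into (g ` S) \<pi> s = g s" if "s \<in> S" for s
      using the_inv_into_f_f[OF injT, of "g s"] gs[OF that] that by simp
    then show "restrict (the_inv_into (g ` S) \<pi>) S = g"
      using g by (intro ext) (auto simp: PiE_def extensional_def restrict_def)
    show "(\<Prod>x\<in>g ` S. w x) = (\<Prod>s\<in>S. w (g s))"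
      using inj by (simp add: prod.reindex)
  next
    fix T assume T: "T \<in> transversals \<pi> X S"
    then have T': "T \<subseteq> X" "inj_on \<pi> T" "\<pi> ` T = S" by (auto simp: transversals_def)
    have "the_inv_into T \<pi> ` S = T"
      using T' the_inv_into_onto by metis
    then show "restrict (the_inv_into T \<pi>) S ` S = T" by simp
    show "restrict (the_inv_into T \<pi>) S \<in> PiE S ?B"
      using T' the_inv_into_into[OF T'(2)] f_the_inv_into_f[OF T'(2)] by fastforce
  qed
  finally show ?thesis by simp
qed

text \<open>Serves both bounds: weight 1 counts the blow-up, and weight \<open>1 / real p\<close>
  gives the reciprocal sum of the integers built from it.\<close>

lemma sum_blow_up:
  fixes w :: "'b \<Rightarrow> 'c :: comm_semiring_1"
  assumes "finite X" "finite \<F>" "\<And>S. S \<in> \<F> \<Longrightarrow> finite S"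
  shows "(\<Sum>T\<in>blow_up \<pi> X \<F>. \<Prod>x\<in>T. w x) = (\<Sum>S\<in>\<F>. \<Prod>s\<in>S. \<Sum>x | x \<in> X \<and> \<pi> x = s. w x)"
  unfolding blow_up_def using assms
  by (subst sum.UNION_disjoint)
    (auto simp: finite_transversals sum_transversals transversals_disjoint intro!: sum.cong)

section \<open>Cartesian powers of families\<close>

text \<open>The factors live on disjoint copies of the ground set, tagged by the index;
  \<open>Sigma\<close> turns a tuple of members into the union of their copies.\<close>

definition family_power :: "nat \<Rightarrow> 'a set set \<Rightarrow> (nat \<times> 'a) set set" where
  "family_power t \<F> = Sigma {..<t} ` ({..<t} \<rightarrow>\<^sub>E \<F>)"

lemma Sigma_inj_on_PiE: "inj_on (Sigma A) (A \<rightarrow>\<^sub>E \<F>)"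
proof (rule inj_onI)
  fix f g assume fg: "f \<in> A \<rightarrow>\<^sub>E \<F>" "g \<in> A \<rightarrow>\<^sub>E \<F>" "Sigma A f = Sigma A g"
  have "f i = g i" if "i \<in> A" for i
    using fg(3) that by blast
  then show "f = g" using fg(1,2) by (meson PiE_ext)
qed

text \<open>The slices of a cosunflower at one index have constant pairwise unions. If distinct,
  they would form a cosunflower in \<open>\<F>\<close>; so by the dichotomy they are all equal. Then
  all members of \<open>H\<close> coincide, but there are at least two.\<close>

lemma family_power_free:
  assumes k: "k \<ge> 3" and free: "cosunflower_free k \<F>"
    and fin: "\<And>S. S \<in> \<F> \<Longrightarrow> finite S" and unif: "\<And>S. S \<in> \<F> \<Longrightarrow> card S = r"
  shows "cosunflower_free k (family_power t \<F>)"
proof (rule cosunflower_freeI)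
  fix H U
  assume H: "H \<subseteq> family_power t \<F>" "finite H" "card H = k"
    and U: "\<And>S T. S \<in> H \<Longrightarrow> T \<in> H \<Longrightarrow> S \<noteq> T \<Longrightarrow> S \<union> T = U"
  define \<pi> where "\<pi> i T = {x. (i, x) \<in> T}" for i :: nat and T :: "(nat \<times> 'a) set"
  have mem: "\<pi> i T \<in> \<F>" if "T \<in> H" "i < t" for i T
  proof -
    obtain f where "T = Sigma {..<t} f" "f \<in> {..<t} \<rightarrow>\<^sub>E \<F>"
      using H(1) \<open>T \<in> H\<close> unfolding family_power_def by blast
    then show ?thesis using \<open>i < t\<close> by (auto simp: \<pi>_def PiE_iff)
  qed
  have un: "\<pi> i S \<union> \<pi> i T = \<pi> i U" if "S \<in> H" "T \<in> H" "S \<noteq> T" for S T i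
    unfolding \<pi>_def U[OF that, symmetric] by blast
  have const: "\<exists>S. \<forall>T\<in>H. \<pi> i T = S" if i: "i < t" for i
  proof -
    have "inj_on (\<pi> i) H \<or> (\<exists>S. \<forall>T\<in>H. \<pi> i T = S)"
    proof (rule uniform_cosunflower_inj_or_const)
      show "finite (\<pi> i T)" if "T \<in> H" for T using fin[OF mem[OF that i]] .
      show "card (\<pi> i T) = r" if "T \<in> H" for T using unif[OF mem[OF that i]] .
      show "\<pi> i S \<union> \<pi> i T = \<pi> i U" if "S \<in> H" "T \<in> H" "S \<noteq> T" for S T using un[OF that] .
    qed
    moreover have "\<not> inj_on (\<pi> i) H"
    proof
      assume "inj_on (\<pi> i) H"
      then show False
        by (rule cosunflower_freeD[OF free H(2,3), of "\<pi> i" "\<pi> i U"]) (use mem i un in auto)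
    qed
    ultimately show ?thesis by blast
  qed
  have T_eq: "T = Sigma {..<t} (\<lambda>i. \<pi> i T)" if "T \<in> H" for T
  proof -
    obtain f where "T = Sigma {..<t} f"
      using H(1) \<open>T \<in> H\<close> unfolding family_power_def by blast
    then show ?thesis by (auto simp: \<pi>_def)
  qed
  have "card H \<ge> 2" using k H by simp
  then obtain H' where "H' \<subseteq> H" "card H' = 2"
    by (meson obtain_subset_with_card_n)
  then obtain T1 T2 where T: "T1 \<in> H" "T2 \<in> H" "T1 \<noteq> T2"
    by (auto simp: card_2_iff)
  have "\<pi> i T1 = \<pi> i T2" if "i < t" for i using const[OF that] T by blast
  then have "Sigma {..<t} (\<lambda>i. \<pi> i T1) = Sigma {..<t} (\<lambda>i. \<pi> i T2)" by auto
  then show False using T T_eq by metis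
qed

lemma family_power_props:
  assumes "\<F> \<subseteq> nsets A r" 
  shows card_family_power: "card (family_power t \<F>) = card \<F> ^ t"
    and family_power_subset: "family_power t \<F> \<subseteq> nsets ({..<t} \<times> A) (r * t)"
proof -
  show "card (family_power t \<F>) = card \<F> ^ t"
    unfolding family_power_def by (simp add: card_image[OF Sigma_inj_on_PiE] card_PiE)
  show "family_power t \<F> \<subseteq> nsets ({..<t} \<times> A) (r * t)"
  proof
    fix T assume "T \<in> family_power t \<F>"
    then obtain f where f: "T = Sigma {..<t} f" "f \<in> {..<t} \<rightarrow>\<^sub>E \<F>"
      by (auto simp: family_power_def)
    then have fi: "f i \<subseteq> A \<and> finite (f i) \<and> card (f i) = r" if "i < t" for i
      using assms that by (auto simp: nsets_def PiE_iff)
    then show "T \<in> nsets ({..<t} \<times> A) (r * t)"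
      using f(1) by (auto simp: nsets_def card_SigmaI)
  qed
qed

lemma cosunflower_free_image:
  assumes inj: "inj_on f A" and sub: "\<F> \<subseteq> Pow A" and free: "cosunflower_free k \<F>"
  shows "cosunflower_free k ((`) f ` \<F>)"
proof (rule cosunflower_freeI)
  fix H U
  assume H: "H \<subseteq> (`) f ` \<F>" "finite H" "card H = k"
    and U: "\<And>S T. S \<in> H \<Longrightarrow> T \<in> H \<Longrightarrow> S \<noteq> T \<Longrightarrow> S \<union> T = U"
  define g where "g = (\<lambda>S. {x\<in>A. f x \<in> S})"
  have gf: "g (f ` S) = S" if "S \<in> \<F>" for S
    using that sub inj by (auto simp: g_def inj_on_def)
  have gH: "f ` g S = S" "g S \<in> \<F>" if "S \<in> H" for S
  proof -
    obtain S' where "S' \<in> \<F>" "S = f ` S'" using H(1) \<open>S \<in> H\<close> by blast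
    then show "f ` g S = S" "g S \<in> \<F>" using gf by simp_all
  qed
  show False
  proof (rule cosunflower_freeD[OF free H(2,3), of g "g U"])
    show "inj_on g H" using gH(1) by (rule inj_on_inverseI)
    show "g ` H \<subseteq> \<F>" using gH(2) by blast
    show "g S \<union> g T = g U" if "S \<in> H" "T \<in> H" "S \<noteq> T" for S T
      unfolding g_def U[OF that, symmetric] by blast
  qed
qed

section \<open>Sets of primes\<close>

lemma prime_factors_prod_primes:
  fixes T :: "nat set"
  assumes "finite T" "\<And>p. p \<in> T \<Longrightarrow> prime p"
  shows "prime_factors (\<Prod>T) = T"
proof -
  have "prime_factorization (\<Prod>p\<in>T. p) = (\<Sum>p\<in>T. prime_factorization p)"
    using assms by (intro prime_factorization_prod) (auto simp: prime_gt_0_nat)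
  also have "\<dots> = (\<Sum>p\<in>T. {#p#})"
    using assms by (intro sum.cong) (auto simp: prime_factorization_prime)
  finally show ?thesis using assms by (simp add: set_mset_sum)
qed

lemma prod_primes_dvd:
  fixes S :: "nat set"
  assumes "finite S" "\<And>p. p \<in> S \<Longrightarrow> prime p" "\<And>p. p \<in> S \<Longrightarrow> p dvd l"
  shows "\<Prod>S dvd l"
  using assms
proof (induction S rule: finite_induct)
  case (insert p S)
  have "coprime p (\<Prod>S)"
    using insert.hyps(2) insert.prems(1) by (intro prod_coprime_right primes_coprime) auto
  then show ?case
    using insert by (simp add: divides_mult)
qed simp

lemma lcm_prod_primes:
  fixes S T :: "nat set"
  assumes "finite S" "finite T" "\<And>p. p \<in> S \<union> T \<Longrightarrow> prime p"
  shows "lcm (\<Prod>S) (\<Prod>T) = \<Prod>(S \<union> T)"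
proof (rule dvd_antisym)
  show "lcm (\<Prod>S) (\<Prod>T) dvd \<Prod>(S \<union> T)"
    using assms by (intro lcm_least prod_dvd_prod_subset) auto
  have "p dvd lcm (\<Prod>S) (\<Prod>T)" if "p \<in> S \<union> T" for p
    using that assms(1,2) by (auto intro: dvd_lcmI1 dvd_lcmI2 dvd_prodI[where f = "\<lambda>x. x"])
  then show "\<Prod>(S \<union> T) dvd lcm (\<Prod>S) (\<Prod>T)"
    using assms by (intro prod_primes_dvd) auto
qed

lemma inj_on_prod_primes:
  fixes \<T> :: "nat set set"
  assumes "\<And>T. T \<in> \<T> \<Longrightarrow> finite T" "\<And>T p. T \<in> \<T> \<Longrightarrow> p \<in> T \<Longrightarrow> prime p"
  shows "inj_on Prod \<T>"
  using assms by (intro inj_on_inverseI[of _ prime_factors]) (simp add: prime_factors_prod_primes)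

lemma lcm_free_prod_primes:
  fixes \<T> :: "nat set set"
  assumes fin: "\<And>T. T \<in> \<T> \<Longrightarrow> finite T" and pr: "\<And>T p. T \<in> \<T> \<Longrightarrow> p \<in> T \<Longrightarrow> prime p"
    and free: "cosunflower_free k \<T>"
  shows "lcm_free k (Prod ` \<T>)"
  unfolding lcm_free_def
proof (rule notI, elim exE conjE)
  fix F l assume F: "F \<subseteq> Prod ` \<T>" "finite F" "card F = k"
    and l: "\<forall>a\<in>F. \<forall>b\<in>F. a \<noteq> b \<longrightarrow> lcm a b = l"
  have pf: "prime_factors a \<in> \<T>" "\<Prod>(prime_factors a) = a" if "a \<in> F" for a
  proof -
    obtain T where "T \<in> \<T>" "a = \<Prod>T" using F(1) \<open>a \<in> F\<close> by blast
    then show "prime_factors a \<in> \<T>" "\<Prod>(prime_factors a) = a"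
      using prime_factors_prod_primes[OF fin pr] by simp_all
  qed
  show False
  proof (rule cosunflower_freeD[OF free F(2,3), of prime_factors "prime_factors l"])
    show "inj_on prime_factors F" using pf(2) by (rule inj_on_inverseI)
    show "prime_factors ` F \<subseteq> \<T>" using pf(1) by blast
    fix a b assume ab: "a \<in> F" "b \<in> F" "a \<noteq> b"
    let ?U = "prime_factors a \<union> prime_factors b"
    have "\<Prod>?U = l"
      using lcm_prod_primes[of "prime_factors a" "prime_factors b"] pf(2) ab l by auto
    then show "?U = prime_factors l"
      using prime_factors_prod_primes[of ?U] by auto
  qed
qed

text \<open>The common factor \<open>d\<close> pulls out of every lcm. With \<open>d\<close> a
  square, this treats all members of \<open>A\<close> with that square part at once.\<close>

lemma cosunflower_free_of_lcm_free:
  fixes \<T> :: "nat set set"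
  assumes fin: "\<And>T. T \<in> \<T> \<Longrightarrow> finite T" and pr: "\<And>T p. T \<in> \<T> \<Longrightarrow> p \<in> T \<Longrightarrow> prime p"
    and free: "lcm_free k A" and d: "d > 0" and A: "\<And>T. T \<in> \<T> \<Longrightarrow> d * \<Prod>T \<in> A"
  shows "cosunflower_free k \<T>"
proof (rule cosunflower_freeI)
  fix H U
  assume H: "H \<subseteq> \<T>" "finite H" "card H = k"
    and U: "\<And>S T. S \<in> H \<Longrightarrow> T \<in> H \<Longrightarrow> S \<noteq> T \<Longrightarrow> S \<union> T = U"
  let ?F = "(\<lambda>T. d * \<Prod>T) ` H"
  have inj: "inj_on Prod H"
    using inj_on_subset[OF inj_on_prod_primes[OF fin pr] H(1)] .
  have "inj_on (\<lambda>T. d * \<Prod>T) H"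
  proof (rule inj_onI)
    fix S T assume ST: "S \<in> H" "T \<in> H" "d * \<Prod>S = d * \<Prod>T"
    then have "\<Prod>S = \<Prod>T" using d by simp
    then show "S = T" using inj_onD[OF inj _ ST(1,2)] by simp
  qed
  then have card: "card ?F = k" using H(3) by (simp add: card_image)
  have sub: "?F \<subseteq> A" using H(1) A by blast
  have lcm: "lcm a b = d * \<Prod>U" if ab: "a \<in> ?F" "b \<in> ?F" "a \<noteq> b" for a b
  proof -
    obtain S T where ST: "S \<in> H" "T \<in> H" "a = d * \<Prod>S" "b = d * \<Prod>T" using ab by blast
    then have ne: "S \<noteq> T" using ab by blast
    have "lcm (\<Prod>S) (\<Prod>T) = \<Prod>(S \<union> T)"
      by (rule lcm_prod_primes) (use ST H(1) fin pr in blast)+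
    also have "S \<union> T = U" using U[OF ST(1,2) ne] .
    finally show ?thesis
      unfolding ST(3,4) by (simp add: lcm_mult_left)
  qed
  have "\<exists>l. \<forall>a\<in>?F. \<forall>b\<in>?F. a \<noteq> b \<longrightarrow> lcm a b = l"
    using lcm by blast
  with sub card H(2) free show False
    unfolding lcm_free_def by (metis finite_imageI)
qed

section \<open>Integers as a square times a product of distinct primes\<close>

definition primes_upto :: "nat \<Rightarrow> nat set" where
  "primes_upto N = {p. prime p \<and> p \<le> N}"

lemma finite_primes_upto [simp]: "finite (primes_upto N)"
  unfolding primes_upto_def by (rule finite_subset[of _ "{..N}"]) auto

lemma square_times_primes:
  assumes "n \<in> {1..N}"
  obtains d T where "d \<in> {1..N}" "T \<subseteq> primes_upto N" "n = d ^ 2 * \<Prod>T"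
proof -
  define m where "m = squarefree_part n"
  define d where "d = square_part n"
  have n: "n = m * d ^ 2" unfolding m_def d_def by (rule squarefree_decompose)
  have "n > 0" using assms by simp
  then have d: "d > 0" and m: "m > 0" using n by (auto intro: Nat.gr0I)
  have "m = (\<Prod>p\<in>prime_factors m. p ^ multiplicity p m)"
    using prod_prime_factors[of m] m by simp
  also have "\<dots> = \<Prod>(prime_factors m)"
  proof (rule prod.cong)
    have "squarefree m" unfolding m_def by simp
    then show "p ^ multiplicity p m = p" if "p \<in> prime_factors m" for p
      using that squarefree_factorial_semiring'[of m] m by auto
  qed simp
  finally have mT: "m = \<Prod>(prime_factors m)" .
  have "d \<le> d ^ 2" "m \<le> n" "d ^ 2 \<le> n"
    using d m by (auto simp: n power2_eq_square)
  then have dN: "d \<in> {1..N}" and mN: "m \<le> N" using d assms by auto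
  have "prime_factors m \<subseteq> primes_upto N"
    using m mN by (auto simp: primes_upto_def prime_factors_dvd dest: dvd_imp_le)
  with dN show ?thesis
    using that[of d "prime_factors m"] n mT by simp
qed

lemma sum_inverse_squares_le: "(\<Sum>d=1..N. 1 / real d ^ 2) \<le> 2"
proof -
  \<comment> \<open>The term \<open>1 / real N\<close> makes the induction telescope; at
    \<open>N = 0\<close> it is 0 by convention.\<close>
  have "(\<Sum>d=1..N. 1 / real d ^ 2) \<le> 2 - 1 / real N"
  proof (induction N)
    case (Suc N)
    have "1 / real (Suc N) ^ 2 \<le> 1 / (real N * real (Suc N))" if "N > 0"
      using that by (intro divide_left_mono) (auto simp: power2_eq_square)
    then have "1 / real (Suc N) ^ 2 \<le> 1 / real N - 1 / real (Suc N)" if "N > 0"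
      using that by (simp add: field_simps)
    then show ?case using Suc by (cases "N = 0") simp_all
  qed simp
  then show ?thesis by (rule order_trans) simp
qed

text \<open>Sorts the members of \<open>A\<close> by their square part. The pairs
  \<open>(d, T)\<close> reach every member, and reaching a value several times could only increase
  the right-hand side.\<close>

lemma sum_reciprocals_le:
  assumes A: "A \<subseteq> {1..N}"
  shows "(\<Sum>a\<in>A. 1 / real a) \<le>
    (\<Sum>d=1..N. 1 / real d ^ 2 * (\<Sum>T | T \<subseteq> primes_upto N \<and> d ^ 2 * \<Prod>T \<in> A. \<Prod>p\<in>T. 1 / real p))"
proof -
  let ?D = "\<lambda>d. {T. T \<subseteq> primes_upto N \<and> d ^ 2 * \<Prod>T \<in> A}"
  let ?I = "Sigma {1..N} ?D"
  let ?f = "\<lambda>(d, T). d ^ 2 * \<Prod>T"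
  have fin: "finite (?D d)" for d
    by (rule finite_subset[of _ "Pow (primes_upto N)"]) auto
  have "A \<subseteq> ?f ` ?I"
  proof
    fix a assume a: "a \<in> A"
    then have "a \<in> {1..N}" using A by blast
    then obtain d T where "d \<in> {1..N}" "T \<subseteq> primes_upto N" "a = d ^ 2 * \<Prod>T"
      by (rule square_times_primes)
    with a have "(d, T) \<in> ?I" "a = ?f (d, T)" by auto
    then show "a \<in> ?f ` ?I" by blast
  qed
  then have "(\<Sum>a\<in>A. 1 / real a) \<le> (\<Sum>a\<in>?f ` ?I. 1 / real a)"
    using fin by (intro sum_mono2) auto
  also have "\<dots> \<le> (\<Sum>x\<in>?I. 1 / real (?f x))"
    using sum_image_le[of ?I "\<lambda>a. 1 / real a" ?f] fin by (simp add: o_def)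
  also have "\<dots> = (\<Sum>(d, T)\<in>?I. 1 / real d ^ 2 * (\<Prod>p\<in>T. 1 / real p))"
    by (intro sum.cong) (auto simp: prod_dividef)
  also have "\<dots> = (\<Sum>d=1..N. \<Sum>T\<in>?D d. 1 / real d ^ 2 * (\<Prod>p\<in>T. 1 / real p))"
    using fin by (subst sum.Sigma) auto
  finally show ?thesis by (simp only: sum_distrib_left)
qed

lemma sum_Pow_prod:
  fixes w :: "'a \<Rightarrow> real"
  assumes "finite P"
  shows "(\<Sum>T\<in>Pow P. \<Prod>p\<in>T. w p) = (\<Prod>p\<in>P. 1 + w p)"
  using prod_add[OF assms, of w "\<lambda>_. 1"] by (simp add: add.commute)

section \<open>Bounds for the sum of 1/p over the primes up to N\<close>

definition prime_recip_sum :: "nat \<Rightarrow> real" where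
  "prime_recip_sum N = (\<Sum>p\<in>primes_upto N. 1 / real p)"

text \<open>Euler's argument: by the square decomposition of all of \<open>{1..N}\<close>, the
  harmonic sum is at most twice the product of the \<open>1 + 1 / real p\<close>. This bounds the
  prime sum from below by log log N - log 2.\<close>

lemma ln_le_exp_prime_recip_sum: "ln (real N + 1) \<le> 2 * exp (prime_recip_sum N)"
proof -
  let ?W = "\<lambda>\<T>. \<Sum>T\<in>\<T>. \<Prod>p\<in>T. 1 / real p"
  have "ln (real N + 1) \<le> harm N" by (rule ln_le_harm)
  also have "\<dots> = (\<Sum>a=1..N. 1 / real a)" by (simp add: harm_def field_simps)
  also have "\<dots> \<le> (\<Sum>d=1..N. 1 / real d ^ 2 * ?W {T. T \<subseteq> primes_upto N \<and> d ^ 2 * \<Prod>T \<in> {1..N}})"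
    by (rule sum_reciprocals_le) simp
  also have "\<dots> \<le> (\<Sum>d=1..N. 1 / real d ^ 2 * ?W (Pow (primes_upto N)))"
    by (intro sum_mono mult_left_mono sum_mono2) (auto intro!: prod_nonneg)
  also have "\<dots> = (\<Sum>d=1..N. 1 / real d ^ 2) * ?W (Pow (primes_upto N))"
    by (simp only: sum_distrib_right)
  also have "\<dots> \<le> 2 * ?W (Pow (primes_upto N))"
    by (intro mult_right_mono sum_inverse_squares_le sum_nonneg prod_nonneg) auto
  also have "?W (Pow (primes_upto N)) = (\<Prod>p\<in>primes_upto N. 1 + 1 / real p)"
    by (simp add: sum_Pow_prod)
  also have "\<dots> \<le> (\<Prod>p\<in>primes_upto N. exp (1 / real p))"
    by (intro prod_mono) (auto simp: add_nonneg_nonneg)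
  also have "\<dots> = exp (prime_recip_sum N)"
    by (simp add: prime_recip_sum_def exp_sum)
  finally show ?thesis by simp
qed

text \<open>A finite form of \<zeta>(1 + s) \<le> 1 + 1/s, with the integral comparison replaced by
  telescoping in n^(-s).\<close>

lemma sum_powr_le:
  assumes s: "s > 0"
  shows "(\<Sum>n=1..X. real n powr - (1 + s)) \<le> 1 + 1 / s"
proof -
  \<comment> \<open>Uses 1 + u \<le> exp u twice: for the logarithm of n / (n + 1), and for the
    power \<open>s\<close> of (n + 1) / n.\<close>
  have step: "real (Suc n) powr - (1 + s) \<le> (real n powr - s - real (Suc n) powr - s) / s" if n: "n > 0" for n
  proof -
    have "1 + s / real (Suc n) \<le> 1 + s * ln (real (Suc n) / real n)"
    proof -
      have "ln (real n / real (Suc n)) \<le> real n / real (Suc n) - 1"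
        using n by (intro ln_le_minus_one) auto
      then have "1 / real (Suc n) \<le> ln (real (Suc n) / real n)"
        using n by (simp add: ln_div field_simps)
      then have "s * (1 / real (Suc n)) \<le> s * ln (real (Suc n) / real n)"
        using s by (intro mult_left_mono) auto
      then show ?thesis by simp
    qed
    also have "\<dots> \<le> (real (Suc n) / real n) powr s"
      using n exp_ge_add_one_self[of "s * ln (real (Suc n) / real n)"] by (simp add: powr_def)
    finally have "(1 + s / real (Suc n)) * real (Suc n) powr - s \<le>
        (real (Suc n) / real n) powr s * real (Suc n) powr - s"
      by (intro mult_right_mono) auto
    also have "\<dots> = real n powr - s"
      using n by (simp add: powr_divide powr_minus field_simps)
    finally have "real (Suc n) powr - s + s * (real (Suc n) powr - s / real (Suc n)) \<le> real n powr - s"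
      by (simp add: algebra_simps)
    moreover have "real (Suc n) powr - (1 + s) = real (Suc n) powr - s / real (Suc n)"
      by (simp add: powr_diff powr_minus_divide)
    ultimately have "s * real (Suc n) powr - (1 + s) \<le> real n powr - s - real (Suc n) powr - s"
      by simp
    then show ?thesis using s by (simp add: pos_le_divide_eq mult.commute)
  qed
  have "(\<Sum>n=1..Suc X. real n powr - (1 + s)) \<le> 1 + (1 - real (Suc X) powr - s) / s" for X
  proof (induction X)
    case (Suc X)
    have "(\<Sum>n=1..Suc (Suc X). real n powr - (1 + s)) =
        (\<Sum>n=1..Suc X. real n powr - (1 + s)) + real (Suc (Suc X)) powr - (1 + s)"
      by simp
    also have "\<dots> \<le> 1 + (1 - real (Suc X) powr - s) / s
        + (real (Suc X) powr - s - real (Suc (Suc X)) powr - s) / s"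
      by (intro add_mono Suc.IH step) simp
    also have "\<dots> = 1 + (1 - real (Suc (Suc X)) powr - s) / s"
      by (simp add: diff_divide_distrib)
    finally show ?case .
  qed simp
  moreover have "1 + (1 - real (Suc X) powr - s) / s \<le> 1 + 1 / s" for X
    using s by (simp add: divide_right_mono)
  ultimately have "(\<Sum>n=1..Suc X. real n powr - (1 + s)) \<le> 1 + 1 / s" for X
    by (rule order_trans)
  then show ?thesis using s by (cases X) auto
qed

text \<open>Expanding the product gives a sum over distinct squarefree integers, each at most the
  product of all primes up to \<open>N\<close>, hence a part of the zeta sum up to that
  product.\<close>

lemma prod_primes_powr_le:
  assumes s: "s > 0"
  shows "(\<Prod>p\<in>primes_upto N. 1 + real p powr - (1 + s)) \<le> 1 + 1 / s"
proof -
  let ?P = "primes_upto N"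
  have pr: "finite T" "\<And>p. p \<in> T \<Longrightarrow> prime p" if "T \<in> Pow ?P" for T
    using that finite_subset[OF _ finite_primes_upto[of N]] by (auto simp: primes_upto_def)
  have inj: "inj_on Prod (Pow ?P)"
    by (rule inj_on_prod_primes) (use pr in blast)+
  have "(\<Prod>p\<in>?P. 1 + real p powr - (1 + s)) = (\<Sum>T\<in>Pow ?P. \<Prod>p\<in>T. real p powr - (1 + s))"
    by (rule sum_Pow_prod[symmetric]) simp
  also have "\<dots> = (\<Sum>T\<in>Pow ?P. real (\<Prod>T) powr - (1 + s))"
    by (intro sum.cong) (simp_all add: prod_powr_distrib of_nat_prod)
  also have "\<dots> = (\<Sum>n\<in>Prod ` Pow ?P. real n powr - (1 + s))"
    by (simp add: sum.reindex[OF inj])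
  also have "\<dots> \<le> (\<Sum>n=1..\<Prod>?P. real n powr - (1 + s))"
  proof (rule sum_mono2)
    show "Prod ` Pow ?P \<subseteq> {1..\<Prod>?P}"
    proof (rule image_subsetI)
      fix T assume T: "T \<in> Pow ?P"
      have "\<Prod>T dvd \<Prod>?P" using T by (intro prod_dvd_prod_subset) auto
      moreover have "\<Prod>?P > 0" by (intro prod_pos) (auto simp: primes_upto_def prime_gt_0_nat)
      moreover have "\<Prod>T > 0" using T by (intro prod_pos) (auto simp: primes_upto_def prime_gt_0_nat)
      ultimately show "\<Prod>T \<in> {1..\<Prod>?P}" using dvd_imp_le[of "\<Prod>T" "\<Prod>?P"] by (simp add: Suc_le_eq)
    qed
  qed auto
  also have "\<dots> \<le> 1 + 1 / s" using s by (rule sum_powr_le)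
  finally show ?thesis .
qed

text \<open>A weak form of Mertens' second theorem that needs no partial summation: for \<open>p \<le> N\<close> the
  exponent \<open>1 + s\<close> with \<open>s = \<delta> / ln N\<close> loses at most a factor \<open>exp \<delta>\<close>, and the sum of the
  \<open>p powr - (1 + s)\<close> is controlled by the Euler product of \<open>\<zeta>(1 + s)\<close>.\<close>

lemma prime_recip_sum_le:
  assumes \<delta>: "\<delta> > 0" and N: "N \<ge> 2"
  shows "prime_recip_sum N \<le> exp \<delta> * (ln (1 + ln (real N) / \<delta>) + 2)"
proof -
  let ?P = "primes_upto N"
  define s where "s = \<delta> / ln (real N)"
  have lnN: "ln (real N) > 0" using N by simp
  have s: "s > 0" using \<delta> lnN by (simp add: s_def)
  have p: "p \<in> {1..N}" if "p \<in> ?P" for p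
    using that prime_gt_0_nat[of p] by (auto simp: primes_upto_def Suc_le_eq)
  have pos: "1 + real p powr - (1 + s) > 0" for p
    by (rule add_pos_nonneg) simp_all
  have "1 / real p \<le> exp \<delta> * real p powr - (1 + s)" if "p \<in> ?P" for p
  proof -
    have "real p powr s \<le> real N powr s"
      using p[OF that] s by (intro powr_mono2) auto
    also have "\<dots> = exp \<delta>" using lnN N by (simp add: powr_def s_def)
    finally have "real p powr s * real p powr - (1 + s) \<le> exp \<delta> * real p powr - (1 + s)"
      by (intro mult_right_mono) auto
    moreover have "real p powr s * real p powr - (1 + s) = 1 / real p"
      using p[OF that] by (simp add: powr_add[symmetric] powr_minus_divide)
    ultimately show ?thesis by simp
  qed
  then have "prime_recip_sum N \<le> (\<Sum>p\<in>?P. exp \<delta> * real p powr - (1 + s))"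
    unfolding prime_recip_sum_def by (rule sum_mono)
  also have "\<dots> = exp \<delta> * (\<Sum>p\<in>?P. real p powr - (1 + s))"
    by (simp add: sum_distrib_left)
  also have "(\<Sum>p\<in>?P. real p powr - (1 + s)) \<le>
      (\<Sum>p\<in>?P. ln (1 + real p powr - (1 + s)) + 1 / real p ^ 2)"
  proof (rule sum_mono)
    fix p assume pP: "p \<in> ?P"
    define x where "x = real p powr - (1 + s)"
    have p1: "real p \<ge> 1" using p[OF pP] by simp
    have "x \<le> real p powr - 1"
      unfolding x_def using p1 s by (intro powr_mono) auto
    then have xp: "x \<le> 1 / real p" using p1 by (simp add: powr_minus_divide)
    also have "\<dots> \<le> 1" using p1 by simp
    finally have "x \<le> 1" .
    have x0: "x \<ge> 0" by (simp add: x_def)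
    \<comment> \<open>Logarithms of the factors sum to the logarithm of the Euler product; the
      quadratic error is absorbed by the sum of 1/p^2.\<close>
    have "x - x ^ 2 \<le> ln (1 + x)"
      using x0 \<open>x \<le> 1\<close> by (rule ln_one_plus_pos_lower_bound)
    moreover have "x ^ 2 \<le> (1 / real p) ^ 2"
      using xp x0 by (rule power_mono)
    ultimately have "x \<le> ln (1 + x) + 1 / real p ^ 2"
      by (simp add: power_divide)
    then show "real p powr - (1 + s) \<le> ln (1 + real p powr - (1 + s)) + 1 / real p ^ 2"
      by (simp add: x_def)
  qed
  also have "\<dots> = (\<Sum>p\<in>?P. ln (1 + real p powr - (1 + s))) + (\<Sum>p\<in>?P. 1 / real p ^ 2)"
    by (rule sum.distrib)
  also have "(\<Sum>p\<in>?P. ln (1 + real p powr - (1 + s))) = ln (\<Prod>p\<in>?P. 1 + real p powr - (1 + s))"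
    using pos by (intro ln_prod[symmetric]) (simp_all add: less_imp_neq[symmetric])
  also have "\<dots> \<le> ln (1 + 1 / s)"
    by (rule ln_mono) (use pos prod_primes_powr_le[OF s] s in \<open>auto intro!: prod_pos\<close>)
  also have "(\<Sum>p\<in>?P. 1 / real p ^ 2) \<le> (\<Sum>d=1..N. 1 / real d ^ 2)"
    using p by (intro sum_mono2) auto
  also have "\<dots> \<le> 2" by (rule sum_inverse_squares_le)
  finally show ?thesis by (simp add: s_def)
qed

lemma prime_recip_sum_asymp_le:
  assumes "c > 1"
  shows "eventually (\<lambda>N. prime_recip_sum N \<le> c * ln (ln (real N))) sequentially"
proof -
  \<comment> \<open>Then exp \<delta> is the square root of \<open>c\<close>, which leaves room
    below \<open>c\<close> for the lower-order terms.\<close>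
  define \<delta> where "\<delta> = ln c / 2"
  have \<delta>: "\<delta> > 0" using assms by (simp add: \<delta>_def)
  have "exp \<delta> < exp (ln c)" using assms by (subst exp_less_cancel_iff) (simp add: \<delta>_def)
  then have less: "exp \<delta> < c" using assms by simp
  have "eventually (\<lambda>N. a * (ln (1 + ln (real N) / \<delta>) + 2) \<le> c * ln (ln (real N))) sequentially"
    if "a < c" for a
    using \<delta> that by real_asymp
  from this[OF less] have "eventually (\<lambda>N. exp \<delta> * (ln (1 + ln (real N) / \<delta>) + 2) \<le> c * ln (ln (real N))) sequentially"
    .
  then show ?thesis
    using eventually_ge_at_top[of 2]
  proof eventually_elim
    case (elim N)
    show ?case using prime_recip_sum_le[OF \<delta> elim(2)] elim(1) by (rule order_trans)
  qed
qed

section \<open>The upper bound\<close>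

definition rate :: "nat \<Rightarrow> nat \<Rightarrow> 'a set set \<Rightarrow> real" where
  "rate n r \<G> = real r / (exp 1 * real n) * real (card \<G>) powr (1 / real r)"

text \<open>Collects the exponents that the lower bound yields; their supremum turns out to be the
  exponent of \<open>lcm_max k\<close>. Up to bijection the ground sets \<open>{1..n}\<close>
  suffice.\<close>

definition rates :: "nat \<Rightarrow> real set" where
  "rates k = {rate n r \<G> | n r (\<G> :: nat set set).
     1 \<le> r \<and> r \<le> n \<and> \<G> \<subseteq> nsets {1..n} r \<and> cosunflower_free k \<G>}"

lemma powr_one_over_nat_le:
  assumes "x \<ge> 0" "y \<ge> 0" "x \<le> y ^ r" "r \<ge> 1"
  shows "x powr (1 / real r) \<le> y"
proof -
  have "x powr (1 / real r) \<le> (y ^ r) powr (1 / real r)"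
    using assms by (intro powr_mono2) auto
  also have "\<dots> = y"
    using assms by (cases "y = 0") (auto simp: powr_powr simp flip: powr_realpow)
  finally show ?thesis .
qed

text \<open>Give each point weight r/n: all subsets together weigh (1 + r/n)^n \<le> e^r, of which
  \<open>\<G>\<close> contributes |\<G>| (r/n)^r. This makes the supremum of \<open>rates k\<close>
  finite.\<close>

lemma rate_le_1:
  assumes r: "1 \<le> r" "r \<le> n" and G: "\<G> \<subseteq> nsets {1..n} r"
  shows "rate n r \<G> \<le> 1"
proof -
  define x where "x = real r / real n"
  have x: "x > 0" using r by (simp add: x_def)
  have "real (card \<G>) * x ^ r = (\<Sum>T\<in>\<G>. \<Prod>i\<in>T. x)"
  proof -
    have "(\<Sum>T\<in>\<G>. \<Prod>i\<in>T. x) = (\<Sum>T\<in>\<G>. x ^ r)"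
      using G by (intro sum.cong) (auto simp: nsets_def)
    then show ?thesis by simp
  qed
  also have "\<dots> \<le> (\<Sum>T\<in>Pow {1..n}. \<Prod>i\<in>T. x)"
    using G x by (intro sum_mono2) (auto simp: nsets_def)
  also have "\<dots> = (1 + x) ^ n" by (subst sum_Pow_prod) auto
  also have "\<dots> \<le> exp x ^ n" using x by (intro power_mono) auto
  also have "\<dots> = exp 1 ^ r" using r by (simp add: x_def flip: exp_of_nat_mult)
  finally have "real (card \<G>) \<le> exp 1 ^ r / x ^ r" using x by (simp add: field_simps)
  also have "\<dots> = (exp 1 / x) ^ r" by (simp add: power_divide)
  finally have "real (card \<G>) powr (1 / real r) \<le> exp 1 / x"
    using x r by (intro powr_one_over_nat_le) auto
  then have "rate n r \<G> \<le> real r / (exp 1 * real n) * (exp 1 / x)"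
    unfolding rate_def by (intro mult_left_mono) auto
  also have "\<dots> = 1" using r by (simp add: x_def)
  finally show ?thesis .
qed

lemma bdd_above_rates: "bdd_above (rates k)"
  by (rule bdd_aboveI[of _ 1]) (auto simp: rates_def rate_le_1)

lemma rate_le_Sup:
  fixes \<G> :: "nat set set"
  assumes "1 \<le> r" "r \<le> n" "\<G> \<subseteq> nsets {1..n} r" "cosunflower_free k \<G>"
  shows "rate n r \<G> \<le> Sup (rates k)"
  using assms by (intro cSup_upper bdd_above_rates) (auto simp: rates_def)

lemma cosunflower_free_singleton: "k \<ge> 2 \<Longrightarrow> cosunflower_free k {S}"
  unfolding cosunflower_free_def by (auto dest: card_mono[rotated])

lemma rates_nonempty:
  assumes "k \<ge> 2"
  shows "rate 1 1 {{1::nat}} \<in> rates k"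
  unfolding rates_def using cosunflower_free_singleton[OF assms, of "{1}"]
  by (fastforce simp: nsets_def)

lemma Sup_rates_pos:
  assumes "k \<ge> 2"
  shows "Sup (rates k) > 0"
proof -
  have "0 < rate 1 1 {{1::nat}}" by (simp add: rate_def)
  also have "\<dots> \<le> Sup (rates k)"
    by (rule cSup_upper[OF rates_nonempty[OF assms] bdd_above_rates])
  finally show ?thesis .
qed

lemma card_le_Sup_rates:
  assumes X: "finite X" and r: "1 \<le> r" and F: "\<F> \<subseteq> nsets X r"
    and free: "cosunflower_free k \<F>" and k: "k \<ge> 2"
  shows "real (card \<F>) \<le> (exp 1 * real (card X) * Sup (rates k) / real r) ^ r"
proof (cases "\<F> = {}")
  case True
  then show ?thesis using Sup_rates_pos[OF k] by simp
next
  case False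
  define n where "n = card X"
  obtain S where "S \<in> \<F>" using False by blast
  then have S: "S \<subseteq> X" "card S = r" using F by (auto simp: nsets_def)
  then have rn: "r \<le> n" using card_mono[OF X S(1)] by (simp add: n_def)
  obtain f where f: "bij_betw f X {1..n}"
    using X by (metis n_def finite_same_card_bij finite_atLeastAtMost card_atLeastAtMost diff_Suc_1)
  then have inj: "inj_on f X" and img: "f ` X = {1..n}" by (auto simp: bij_betw_def)
  let ?G = "(`) f ` \<F>"
  have sub: "\<F> \<subseteq> Pow X" using F by (auto simp: nsets_def)
  have card: "card ?G = card \<F>"
    by (rule card_image) (meson inj sub inj_on_image_Pow inj_on_subset)
  have "?G \<subseteq> nsets {1..n} r"
  proof (rule image_subsetI)
    fix T assume "T \<in> \<F>"
    then have T: "T \<subseteq> X" "finite T" "card T = r" using F by (auto simp: nsets_def)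
    then show "f ` T \<in> nsets {1..n} r"
      using img inj card_image[OF inj_on_subset[OF inj T(1)]] by (auto simp: nsets_def)
  qed
  then have "rate n r ?G \<le> Sup (rates k)"
    using r rn cosunflower_free_image[OF inj sub free] by (intro rate_le_Sup)
  then have le: "real (card \<F>) powr (1 / real r) \<le> exp 1 * real n * Sup (rates k) / real r"
    using r rn by (simp add: rate_def card field_simps)
  have "real (card \<F>) = (real (card \<F>) powr (1 / real r)) ^ r"
    using r by (cases "card \<F> = 0") (auto simp: powr_powr simp flip: powr_realpow)
  also have "\<dots> \<le> (exp 1 * real n * Sup (rates k) / real r) ^ r"
    using le by (intro power_mono) auto
  finally show ?thesis by (simp add: n_def)
qed

section \<open>Weights of cosunflower-free families\<close>

text \<open>With D/p clones of each \<open>p\<close>, the cardinality of the blow-up is D^r times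
  the weight of \<open>\<F>\<close>, and that of its ground set is D times the sum of 1/p. In the
  cardinality bound D^r cancels.\<close>

lemma uniform_weight_le:
  assumes P: "finite P" "\<And>p. p \<in> P \<Longrightarrow> p > (0::nat)" and r: "1 \<le> r" and F: "\<F> \<subseteq> nsets P r"
    and free: "cosunflower_free k \<F>" and k: "k \<ge> 3"
  shows "(\<Sum>T\<in>\<F>. \<Prod>p\<in>T. 1 / real p) \<le> (exp 1 * (\<Sum>p\<in>P. 1 / real p) * Sup (rates k) / real r) ^ r"
proof -
  \<comment> \<open>Every member of \<open>P\<close> divides \<open>D\<close>, so the numbers of
    clones are exact.\<close>
  define D where "D = \<Prod>P"
  define X where "X = Sigma P (\<lambda>p. {..<D div p})"
  have D: "real D > 0" using P by (simp add: D_def prod_pos)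
  have div: "real (D div p) = real D * (1 / real p)" if "p \<in> P" for p
    using that P(1) by (simp add: D_def real_of_nat_div dvd_prodI[where f = "\<lambda>x. x"])
  have X: "finite X" using P by (simp add: X_def)
  have cX: "real (card X) = real D * (\<Sum>p\<in>P. 1 / real p)"
    using P by (simp add: X_def card_SigmaI div sum_distrib_left)
  have finF: "finite \<F>" "\<And>T. T \<in> \<F> \<Longrightarrow> finite T" "\<And>T. T \<in> \<F> \<Longrightarrow> card T = r"
    "\<And>T. T \<in> \<F> \<Longrightarrow> T \<subseteq> P"
    using F finite_subset[OF F finite_imp_finite_nsets[OF P(1)]] by (auto simp: nsets_def)
  let ?B = "blow_up fst X \<F>"
  have B: "?B \<subseteq> nsets X r"
  proof
    fix T assume T: "T \<in> ?B"
    then show "T \<in> nsets X r"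
      using blow_up_subset[OF T] blow_up_card[OF T finF(3)] finite_subset[OF _ X] by (simp add: nsets_def)
  qed
  have "real D ^ r * (\<Sum>T\<in>\<F>. \<Prod>p\<in>T. 1 / real p) = (\<Sum>T\<in>\<F>. \<Prod>p\<in>T. real D * (1 / real p))"
    unfolding sum_distrib_left
    by (intro sum.cong refl) (simp only: prod.distrib prod_constant finF(3))
  also have "\<dots> = (\<Sum>T\<in>\<F>. \<Prod>p\<in>T. \<Sum>x | x \<in> X \<and> fst x = p. 1)"
  proof (intro sum.cong prod.cong refl)
    fix T p assume "T \<in> \<F>" "p \<in> T"
    then have p: "p \<in> P" using finF(4) by blast
    then have "{x. x \<in> X \<and> fst x = p} = Pair p ` {..<D div p}" by (auto simp: X_def)
    then show "real D * (1 / real p) = (\<Sum>x | x \<in> X \<and> fst x = p. 1)"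
      using div[OF p] by (simp add: card_image inj_on_def)
  qed
  also have "\<dots> = (\<Sum>T\<in>?B. \<Prod>x\<in>T. 1)"
    by (rule sum_blow_up[OF X finF(1,2), symmetric])
  also have "\<dots> = real (card ?B)" by simp
  also have "\<dots> \<le> (exp 1 * real (card X) * Sup (rates k) / real r) ^ r"
    using k by (intro card_le_Sup_rates X r B blow_up_cosunflower_free[OF k free X finF(3)]) auto
  also have "\<dots> = real D ^ r * (exp 1 * (\<Sum>p\<in>P. 1 / real p) * Sup (rates k) / real r) ^ r"
    unfolding cX power_mult_distrib[symmetric] by (simp add: field_simps)
  finally show ?thesis using D by simp
qed

text \<open>The geometric factor makes the bound summable over \<open>r\<close>.\<close>

lemma exp_power_le:
  assumes y: "y \<ge> 0" and \<eta>: "\<eta> > 0"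
  shows "(exp 1 * y / real r) ^ r \<le> exp (y * (1 + \<eta>)) * (1 / (1 + \<eta>)) ^ r"
proof (cases "r = 0")
  case False
  \<comment> \<open>For this \<open>z\<close>, the \<open>r\<close>-th power of e z \<le> e^z has
    right-hand side exp (y (1 + \<eta>)), and e z / (1 + \<eta>) is e y / r.\<close>
  define z where "z = y * (1 + \<eta>) / real r"
  have z: "z \<ge> 0" using assms by (simp add: z_def)
  have "exp 1 * z \<le> exp 1 * exp (z - 1)"
    using exp_ge_add_one_self[of "z - 1"] by (intro mult_left_mono) auto
  then have "exp 1 * z \<le> exp z" by (simp flip: exp_add)
  then have "(exp 1 * z) ^ r \<le> exp z ^ r" using z by (intro power_mono) auto
  also have "\<dots> = exp (y * (1 + \<eta>))"
    using False by (simp add: z_def flip: exp_of_nat_mult)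
  finally have "(exp 1 * z) ^ r * (1 / (1 + \<eta>)) ^ r \<le> exp (y * (1 + \<eta>)) * (1 / (1 + \<eta>)) ^ r"
    using \<eta> by (intro mult_right_mono) auto
  moreover have "exp 1 * z * (1 / (1 + \<eta>)) = exp 1 * y / real r"
    using \<eta> by (simp add: z_def)
  ultimately show ?thesis by (simp add: power_mult_distrib[symmetric])
qed (use assms in simp)

text \<open>Splits \<open>\<F>\<close> by cardinality; the bounds on the layers are dominated by a
  geometric series of sum \<open>(1 + \<eta>) / \<eta>\<close>.\<close>

lemma weight_le:
  assumes P: "finite P" "\<And>p. p \<in> P \<Longrightarrow> p > (0::nat)" and F: "\<F> \<subseteq> Pow P"
    and free: "cosunflower_free k \<F>" and k: "k \<ge> 3" and \<eta>: "\<eta> > 0"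
  shows "(\<Sum>T\<in>\<F>. \<Prod>p\<in>T. 1 / real p) \<le>
    exp ((\<Sum>p\<in>P. 1 / real p) * Sup (rates k) * (1 + \<eta>)) * ((1 + \<eta>) / \<eta>)"
proof -
  let ?y = "(\<Sum>p\<in>P. 1 / real p) * Sup (rates k)"
  have y: "?y \<ge> 0" using Sup_rates_pos[of k] k by (auto intro!: mult_nonneg_nonneg sum_nonneg)
  have finF: "finite \<F>" using F P(1) by (auto intro: finite_subset)
  have unif: "(\<Sum>T | T \<in> \<F> \<and> card T = r. \<Prod>p\<in>T. 1 / real p) \<le>
      exp (?y * (1 + \<eta>)) * (1 / (1 + \<eta>)) ^ r" for r
  proof (cases "r = 0")
    case True
    \<comment> \<open>Rates concern only \<open>r \<ge> 1\<close>; the layer \<open>r = 0\<close>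
      contains at most the empty set, of weight 1.\<close>
    have "T = {}" if "T \<in> \<F>" "card T = 0" for T
      using that F finite_subset[OF _ P(1), of T] by auto
    then have "(\<Sum>T | T \<in> \<F> \<and> card T = r. \<Prod>p\<in>T. 1 / real p) \<le> (\<Sum>T\<in>{{}::nat set}. \<Prod>p\<in>T. 1 / real p)"
      using True by (intro sum_mono2) auto
    also have "\<dots> \<le> exp (?y * (1 + \<eta>))" using y \<eta> by simp
    finally show ?thesis using True by simp
  next
    case False
    have "(\<Sum>T | T \<in> \<F> \<and> card T = r. \<Prod>p\<in>T. 1 / real p) \<le>
        (exp 1 * (\<Sum>p\<in>P. 1 / real p) * Sup (rates k) / real r) ^ r"
      using False F P
      by (intro uniform_weight_le P cosunflower_free_subset[OF free] k)
        (auto simp: nsets_def dest: finite_subset)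
    also have "\<dots> \<le> exp (?y * (1 + \<eta>)) * (1 / (1 + \<eta>)) ^ r"
      using exp_power_le[OF y \<eta>, of r] by (simp add: mult.assoc)
    finally show ?thesis .
  qed
  have "(\<Sum>T\<in>\<F>. \<Prod>p\<in>T. 1 / real p) = (\<Sum>r\<in>{..card P}. \<Sum>T | T \<in> \<F> \<and> card T = r. \<Prod>p\<in>T. 1 / real p)"
    using finF F P(1) by (intro sum.group[symmetric]) (auto intro: card_mono)
  also have "\<dots> \<le> (\<Sum>r\<in>{..card P}. exp (?y * (1 + \<eta>)) * (1 / (1 + \<eta>)) ^ r)"
    by (intro sum_mono unif)
  also have "\<dots> = exp (?y * (1 + \<eta>)) * (\<Sum>r\<in>{..card P}. (1 / (1 + \<eta>)) ^ r)"
    by (simp add: sum_distrib_left)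
  also have "\<dots> \<le> exp (?y * (1 + \<eta>)) * ((1 + \<eta>) / \<eta>)"
  proof (intro mult_left_mono)
    have "(\<Sum>r\<in>{..card P}. (1 / (1 + \<eta>)) ^ r) \<le> (\<Sum>r. (1 / (1 + \<eta>)) ^ r)"
      using \<eta> by (intro sum_le_suminf summable_geometric) auto
    also have "\<dots> = (1 + \<eta>) / \<eta>"
      using \<eta> by (subst suminf_geometric) (auto simp: field_simps)
    finally show "(\<Sum>r\<in>{..card P}. (1 / (1 + \<eta>)) ^ r) \<le> (1 + \<eta>) / \<eta>" .
  qed simp
  finally show ?thesis .
qed

section \<open>Upper bound for the reciprocal sums\<close>

lemma finite_lcm_sums: "finite {(\<Sum>a\<in>A. 1 / real a) | A. A \<subseteq> {1..N} \<and> lcm_free k A}"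
  by (rule finite_surj[of "Pow {1..N}" _ "\<lambda>A. \<Sum>a\<in>A. 1 / real a"]) auto

lemma lcm_max_ge:
  assumes "A \<subseteq> {1..N}" "lcm_free k A"
  shows "(\<Sum>a\<in>A. 1 / real a) \<le> lcm_max k N"
  unfolding lcm_max_def using assms by (intro Max_ge finite_lcm_sums) blast

lemma lcm_free_singleton: "k \<ge> 2 \<Longrightarrow> lcm_free k {a}"
  unfolding lcm_free_def by (auto dest: card_mono[rotated])

lemma lcm_max_ge_1:
  assumes "k \<ge> 2" "N \<ge> 1"
  shows "lcm_max k N \<ge> 1"
  using lcm_max_ge[of "{1}" N k] lcm_free_singleton[of k 1] assms by simp

text \<open>For each square part, the squarefree parts form a cosunflower-free family of sets of
  primes, whose weight is bounded independently of \<open>d\<close>; the sum of 1/d^2 costs the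
  factor 2.\<close>

lemma lcm_max_le:
  assumes k: "k \<ge> 3" and \<eta>: "\<eta> > 0"
  shows "lcm_max k N \<le> 2 * (exp (prime_recip_sum N * Sup (rates k) * (1 + \<eta>)) * ((1 + \<eta>) / \<eta>))"
    (is "_ \<le> 2 * ?b")
proof -
  have b: "?b \<ge> 0" using \<eta> by simp
  have "(\<Sum>a\<in>A. 1 / real a) \<le> 2 * ?b" if A: "A \<subseteq> {1..N}" "lcm_free k A" for A
  proof -
    have "(\<Sum>T | T \<subseteq> primes_upto N \<and> d ^ 2 * \<Prod>T \<in> A. \<Prod>p\<in>T. 1 / real p) \<le> ?b" if "d \<in> {1..N}" for d
      unfolding prime_recip_sum_def
    proof (rule weight_le[OF _ _ _ _ k \<eta>])
      let ?T = "{T. T \<subseteq> primes_upto N \<and> d ^ 2 * \<Prod>T \<in> A}"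
      show "cosunflower_free k ?T"
      proof (rule cosunflower_free_of_lcm_free[OF _ _ A(2)])
        show "finite T" if "T \<in> ?T" for T
          using that finite_subset[OF _ finite_primes_upto[of N]] by blast
        show "prime p" if "T \<in> ?T" "p \<in> T" for T p
          using that by (auto simp: primes_upto_def)
        show "d ^ 2 > 0" using \<open>d \<in> {1..N}\<close> by simp
      qed simp
    qed (auto simp: primes_upto_def prime_gt_0_nat)
    then have "(\<Sum>d=1..N. 1 / real d ^ 2 * (\<Sum>T | T \<subseteq> primes_upto N \<and> d ^ 2 * \<Prod>T \<in> A. \<Prod>p\<in>T. 1 / real p))
        \<le> (\<Sum>d=1..N. 1 / real d ^ 2 * ?b)"
      by (intro sum_mono mult_left_mono) auto
    also have "\<dots> = (\<Sum>d=1..N. 1 / real d ^ 2) * ?b" by (simp only: sum_distrib_right)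
    also have "\<dots> \<le> 2 * ?b" using b by (intro mult_right_mono sum_inverse_squares_le)
    finally show ?thesis using sum_reciprocals_le[OF A(1)] by linarith
  qed
  moreover have "lcm_free k {}" using k by (auto simp: lcm_free_def)
  then have "{(\<Sum>a\<in>A. 1 / real a) | A. A \<subseteq> {1..N} \<and> lcm_free k A} \<noteq> {}" by blast
  ultimately show ?thesis
    unfolding lcm_max_def using finite_lcm_sums by (subst Max_le_iff) auto
qed

lemma lcm_max_upper:
  assumes k: "k \<ge> 3" and c: "c > Sup (rates k)"
  shows "eventually (\<lambda>N. ln (lcm_max k N) / ln (ln (real N)) < c) sequentially"
proof -
  define S where "S = Sup (rates k)"
  have S: "S > 0" using Sup_rates_pos[of k] k by (simp add: S_def)
  \<comment> \<open>The aim is (1 + \<eta>)^2 S < c: one factor 1 + \<eta> comes from the geometric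
    damping, the other from the prime sum.\<close>
  define u where "u = sqrt (c / S)"
  have u: "u > 1" using c S by (simp add: u_def S_def)
  define \<eta> where "\<eta> = (u - 1) / 2"
  have \<eta>: "\<eta> > 0" using u by (simp add: \<eta>_def)
  define K where "K = ln (2 * ((1 + \<eta>) / \<eta>))"
  define a where "a = (1 + \<eta>) ^ 2 * S"
  have "(1 + \<eta>) ^ 2 < u ^ 2" using u by (intro power_strict_mono) (auto simp: \<eta>_def field_simps)
  also have "u ^ 2 = c / S" using c S by (simp add: u_def S_def)
  finally have "a < c" using S by (simp add: a_def pos_less_divide_eq)
  then have "eventually (\<lambda>N. K + a * ln (ln (real N)) < c * ln (ln (real N))) sequentially"
    by real_asymp
  moreover have "eventually (\<lambda>N. prime_recip_sum N \<le> (1 + \<eta>) * ln (ln (real N))) sequentially"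
    using \<eta> by (intro prime_recip_sum_asymp_le) simp
  moreover have "eventually (\<lambda>N. ln (ln (real N)) > 0) sequentially" by real_asymp
  ultimately show ?thesis
    using eventually_ge_at_top[of 1]
  proof eventually_elim
    case (elim N)
    let ?E = "prime_recip_sum N * S * (1 + \<eta>)"
    have "ln (lcm_max k N) \<le> ln (2 * ((1 + \<eta>) / \<eta>) * exp ?E)"
    proof (rule ln_mono)
      show "lcm_max k N \<le> 2 * ((1 + \<eta>) / \<eta>) * exp ?E"
        using lcm_max_le[OF k \<eta>, of N] by (simp only: S_def mult_ac)
      show "lcm_max k N > 0"
        using lcm_max_ge_1[of k N] k elim(4) by simp
    qed
    also have "\<dots> = K + ?E"
      unfolding K_def using \<eta> by (subst ln_mult) auto
    also have "?E \<le> (1 + \<eta>) * ln (ln (real N)) * S * (1 + \<eta>)"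
      using elim(2) S \<eta> by (intro mult_right_mono) auto
    also have "\<dots> = a * ln (ln (real N))" by (simp add: a_def power2_eq_square mult_ac)
    also note elim(1)
    finally show ?case using elim(3) by (simp add: pos_divide_less_eq)
  qed
qed

section \<open>The lower bound\<close>

lemma subset_sum_between:
  fixes w :: "'a \<Rightarrow> real"
  assumes "finite P" "\<And>x. x \<in> P \<Longrightarrow> w x \<le> h" "0 \<le> q" "0 \<le> h" "q \<le> sum w P"
  shows "\<exists>Q\<subseteq>P. q \<le> sum w Q \<and> sum w Q \<le> q + h"
  using assms
proof (induction P rule: finite_induct)
  case (insert x P)
  show ?case
  proof (cases "q \<le> sum w P")
    case True
    then show ?thesis using insert by (metis insertCI subset_insertI2)
  next
    case False
    then show ?thesis
      using insert.hyps insert.prems(1)[OF insertI1] insert.prems(4)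
      by (intro exI[of _ "insert x P"]) auto
  qed
qed auto

text \<open>Greedy: cut off a class of mass between q and q + h for one colour; the rest still has
  mass q + h for each remaining colour.\<close>

lemma balanced_colouring:
  fixes w :: "'a \<Rightarrow> real"
  assumes "finite J" "finite P" "\<And>x. x \<in> P \<Longrightarrow> 0 \<le> w x" "\<And>x. x \<in> P \<Longrightarrow> w x \<le> h" "0 \<le> q" "0 \<le> h"
    and "real (card J) * (q + h) \<le> sum w P"
  shows "\<exists>\<pi>. \<forall>j\<in>J. q \<le> (\<Sum>x | x \<in> P \<and> \<pi> x = j. w x)"
  using assms
proof (induction J arbitrary: P rule: finite_induct)
  case (insert j J)
  have "0 \<le> real (card J) * (q + h)" using insert.prems by simp
  then have "q + h \<le> sum w P" using insert.hyps insert.prems(6) by (simp add: algebra_simps)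
  then have "q \<le> sum w P" using insert.prems(5) by simp
  then obtain Q where Q: "Q \<subseteq> P" "q \<le> sum w Q" "sum w Q \<le> q + h"
    using subset_sum_between[of P w h q] insert.prems by blast
  have "real (card J) * (q + h) \<le> sum w (P - Q)"
    using insert.hyps insert.prems(1,6) Q by (simp add: sum_diff algebra_simps)
  then obtain \<pi> where \<pi>: "\<forall>j\<in>J. q \<le> (\<Sum>x | x \<in> P - Q \<and> \<pi> x = j. w x)"
    using insert.IH[of "P - Q"] insert.prems by auto
  define \<pi>' where "\<pi>' x = (if x \<in> Q then j else \<pi> x)" for x
  have "q \<le> (\<Sum>x | x \<in> P \<and> \<pi>' x = i. w x)" if i: "i \<in> insert j J" for i
  proof (cases "i = j")
    case True
    \<comment> \<open>\<open>\<pi>\<close> may use the colour \<open>j\<close> outside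
      \<open>Q\<close> too, which only adds nonnegative weight.\<close>
    have "sum w Q \<le> (\<Sum>x | x \<in> P \<and> \<pi>' x = j. w x)"
      using insert.prems(1,2) Q(1) by (intro sum_mono2) (auto simp: \<pi>'_def)
    then show ?thesis using True Q by simp
  next
    case False
    then have "{x. x \<in> P \<and> \<pi>' x = i} = {x. x \<in> P - Q \<and> \<pi> x = i}"
      by (auto simp: \<pi>'_def)
    then show ?thesis using \<pi> i False by auto
  qed
  then show ?case by blast
qed simp

section \<open>The construction behind the lower bound\<close>

text \<open>The set consists of the products of the transversals of the \<open>t\<close>-th power of
  \<open>\<G>\<close>, with the classes of \<open>\<pi>\<close> as clones. Each is a product of r t
  primes up to \<open>Y\<close>, hence at most \<open>N\<close>, and each of the |\<G>|^t members of
  the power contributes at least q^(r t).\<close>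

lemma lcm_max_ge_power:
  fixes \<G> :: "nat set set"
  assumes k: "k \<ge> 3" and G: "\<G> \<subseteq> nsets {1..n} r" and free: "cosunflower_free k \<G>"
    and P: "P \<subseteq> primes_upto Y" and Y: "Y ^ (r * t) \<le> N" and q: "q \<ge> 0"
    and \<pi>: "\<And>j. j \<in> {..<t} \<times> {1..n} \<Longrightarrow> q \<le> (\<Sum>p | p \<in> P \<and> \<pi> p = j. 1 / real p)"
  shows "(real (card \<G>) * q ^ r) ^ t \<le> lcm_max k N"
proof -
  let ?F = "family_power t \<G>"
  let ?B = "blow_up \<pi> P ?F"
  have finP: "finite P" using P finite_primes_upto by (rule finite_subset)
  have Gp: "finite S" "card S = r" if "S \<in> \<G>" for S using G that by (auto simp: nsets_def)
  have Fsub: "?F \<subseteq> nsets ({..<t} \<times> {1..n}) (r * t)" by (rule family_power_subset[OF G])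
  then have Fp: "finite S" "card S = r * t" "S \<subseteq> {..<t} \<times> {1..n}" if "S \<in> ?F" for S
    using that by (auto simp: nsets_def)
  have finF: "finite ?F" by (rule finite_subset[OF Fsub]) (simp add: finite_imp_finite_nsets)
  have Ffree: "cosunflower_free k ?F" by (rule family_power_free[OF k free Gp])
  have Bfree: "cosunflower_free k ?B"
    by (rule blow_up_cosunflower_free[OF k Ffree finP Fp(2)])
  have B: "T \<subseteq> P" "finite T" "card T = r * t" if "T \<in> ?B" for T
    using blow_up_subset[OF that] blow_up_card[OF that Fp(2)] finite_subset[OF _ finP] by auto
  have pr: "prime p" "p \<le> Y" if "T \<in> ?B" "p \<in> T" for T p
    using B(1)[OF that(1)] that(2) P by (auto simp: primes_upto_def)
  have "\<Prod>T \<in> {1..N}" if T: "T \<in> ?B" for T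
  proof -
    have "\<Prod>T \<le> (\<Prod>p\<in>T. Y)" using pr[OF T] by (intro prod_mono) auto
    also have "\<dots> \<le> N" using B(3)[OF T] Y by simp
    finally have "\<Prod>T \<le> N" .
    moreover have "\<Prod>T > 0" using pr[OF T] by (intro prod_pos) (auto simp: prime_gt_0_nat)
    ultimately show ?thesis by (simp add: Suc_le_eq)
  qed
  then have AN: "Prod ` ?B \<subseteq> {1..N}" by blast
  have Afree: "lcm_free k (Prod ` ?B)"
    by (rule lcm_free_prod_primes[OF B(2) pr(1) Bfree])
  have inj: "inj_on Prod ?B" by (rule inj_on_prod_primes[OF B(2) pr(1)])
  have "(real (card \<G>) * q ^ r) ^ t = (\<Sum>S\<in>?F. q ^ (r * t))"
    by (simp add: card_family_power[OF G] power_mult_distrib power_mult)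
  also have "\<dots> \<le> (\<Sum>S\<in>?F. \<Prod>s\<in>S. \<Sum>p | p \<in> P \<and> \<pi> p = s. 1 / real p)"
  proof (rule sum_mono)
    fix S assume S: "S \<in> ?F"
    have "q ^ (r * t) = (\<Prod>s\<in>S. q)" using Fp(2)[OF S] by simp
    also have "\<dots> \<le> (\<Prod>s\<in>S. \<Sum>p | p \<in> P \<and> \<pi> p = s. 1 / real p)"
      using q \<pi> Fp(3)[OF S] by (intro prod_mono) blast
    finally show "q ^ (r * t) \<le> (\<Prod>s\<in>S. \<Sum>p | p \<in> P \<and> \<pi> p = s. 1 / real p)" .
  qed
  also have "\<dots> = (\<Sum>T\<in>?B. \<Prod>p\<in>T. 1 / real p)"
    by (rule sum_blow_up[OF finP finF Fp(1), symmetric])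
  also have "\<dots> = (\<Sum>a\<in>Prod ` ?B. 1 / real a)"
    by (simp add: sum.reindex[OF inj] prod_dividef)
  also have "\<dots> \<le> lcm_max k N" by (rule lcm_max_ge[OF AN Afree])
  finally show ?thesis .
qed

text \<open>\<open>Y\<close> is the floor of the \<open>h\<close>-th root of \<open>N\<close>. That
  root is below Y + 1, so the Euler bound, stated for \<open>ln (real Y + 1)\<close>, absorbs the
  rounding.\<close>

lemma root_floor:
  fixes N h :: nat
  assumes h: "h \<ge> 1" and N: "ln (real N) > 0"
  obtains Y where "Y ^ h \<le> N" "ln (ln (real N)) - ln (real h) - ln 2 \<le> prime_recip_sum Y"
proof -
  have N0: "real N > 0" using N by (cases "N = 0") auto
  define x where "x = real N powr (1 / real h)"
  have x0: "x > 0" using N0 by (simp add: x_def)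
  define Y where "Y = nat \<lfloor>x\<rfloor>"
  have Yx: "real Y \<le> x" "x < real Y + 1" using x0 unfolding Y_def by linarith+
  have "real Y ^ h \<le> x ^ h" using Yx by (intro power_mono) auto
  also have "\<dots> = real N"
    using h N0 x0 by (simp add: x_def powr_powr flip: powr_realpow)
  finally have "real (Y ^ h) \<le> real N" by simp
  then have "Y ^ h \<le> N" by (simp only: of_nat_le_iff)
  moreover have "ln (ln (real N)) - ln (real h) - ln 2 \<le> prime_recip_sum Y"
  proof -
    have "ln (real N) / real h = ln x" using N0 by (simp add: x_def ln_powr)
    also have "\<dots> \<le> ln (real Y + 1)" using x0 Yx by (intro ln_mono) auto
    also have "\<dots> \<le> 2 * exp (prime_recip_sum Y)" by (rule ln_le_exp_prime_recip_sum)
    finally have "ln (real N) / real h / 2 \<le> exp (prime_recip_sum Y)" by simp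
    then have "ln (ln (real N) / real h / 2) \<le> ln (exp (prime_recip_sum Y))"
      using N h by (intro ln_mono) auto
    then show ?thesis using N h by (simp add: ln_div ln_mult)
  qed
  ultimately show ?thesis by (rule that)
qed

text \<open>Take t near \<beta> L / r, where L = log log N, and n t classes of mass \<open>q\<close>
  with M q^r = e^r; the sum is then at least e^(r t) \<ge> (log N)^\<beta>. The classes need mass
  about (\<beta> / \<alpha>) L < L, and this slack pays for all errors.\<close>

lemma lcm_max_lower_pos:
  fixes \<G> :: "nat set set"
  assumes k: "k \<ge> 3" and r: "1 \<le> r" "r \<le> n" and G: "\<G> \<subseteq> nsets {1..n} r"
    and free: "cosunflower_free k \<G>" and \<beta>: "0 < \<beta>" "\<beta> < rate n r \<G>"
  shows "eventually (\<lambda>N. ln (real N) powr \<beta> \<le> lcm_max k N) sequentially"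
proof -
  define \<alpha> where "\<alpha> = rate n r \<G>"
  define M where "M = real (card \<G>)"
  have \<alpha>: "\<alpha> > 0" "\<beta> < \<alpha>" using \<beta> by (simp_all add: \<alpha>_def)
  have M: "M > 0" using \<alpha> r by (auto simp: \<alpha>_def rate_def M_def intro: Nat.gr0I)
  \<comment> \<open>This is the class mass L / (n t) at the optimal t = \<alpha> L / r; it makes
    each of the \<open>t\<close> factors equal to e^r.\<close>
  define q where "q = real r / (real n * \<alpha>)"
  have q: "q > 0" using r \<alpha> by (simp add: q_def)
  have Mq: "M * q ^ r = exp 1 ^ r"
  proof -
    have "M powr (1 / real r) * q = exp 1"
      using r M by (simp add: q_def \<alpha>_def rate_def M_def)
    then have "(M powr (1 / real r)) ^ r * q ^ r = exp 1 ^ r"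
      by (simp flip: power_mult_distrib)
    moreover have "(M powr (1 / real r)) ^ r = M"
      using r M by (simp add: powr_powr flip: powr_realpow)
    ultimately show ?thesis by simp
  qed
  \<comment> \<open>Primes up to \<open>w\<close> will be discarded, so that each remaining one
    weighs at most 1/w, which bounds the overshoot of a class. Beyond \<open>B\<close>, the total
    overshoot is small enough for \<open>a < 1\<close>.\<close>
  define B where "B = real n * \<beta> / real r / (1 - \<beta> / \<alpha>)"
  have "\<beta> / \<alpha> < 1" using \<alpha> by simp
  then have B: "B > 0" using r \<beta> by (simp add: B_def)
  obtain w :: nat where Bw: "B < real w" using reals_Archimedean2 by blast
  have w: "w > 0" using B Bw by (cases w) auto
  define a where "a = \<beta> / \<alpha> + real n * \<beta> / (real r * real w)"
  have "real n * \<beta> / real r / real w < 1 - \<beta> / \<alpha>"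
    using Bw w \<open>\<beta> / \<alpha> < 1\<close> unfolding B_def by (simp only: pos_divide_less_eq of_nat_0_less_iff diff_gt_0_iff_gt mult.commute)
  then have a: "a < 1" by (simp add: a_def)
  define K where "K = ln 2 + prime_recip_sum w + real r / \<alpha> + real n / real w"
  \<comment> \<open>\<open>K\<close> collects the constant losses; the extra logarithm bounds ln (r
    t), the mass lost by using only primes up to the (r t)-th root of N.\<close>
  have "eventually (\<lambda>N. a * ln (ln (real N)) + ln (\<beta> * ln (ln (real N)) + real r) + K
      \<le> ln (ln (real N))) sequentially"
    using a \<beta> by real_asymp
  moreover have "eventually (\<lambda>N. ln (ln (real N)) > 0) sequentially" by real_asymp
  moreover have "eventually (\<lambda>N. ln (real N) > 0) sequentially" by real_asymp
  ultimately show ?thesis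
  proof eventually_elim
    case (elim N)
    define x where "x = ln (ln (real N))"
    \<comment> \<open>Rounding up gives r t \<ge> \<beta> x, while r t \<le> \<beta> x + r keeps the
      required mass under control.\<close>
    define t where "t = nat \<lceil>\<beta> * x / real r\<rceil>"
    have bx: "\<beta> * x / real r > 0" using elim \<beta> r by (simp add: x_def)
    have t: "\<beta> * x / real r \<le> real t" "real t \<le> \<beta> * x / real r + 1"
      using bx unfolding t_def by linarith+
    have t1: "r * t \<ge> 1" using bx t(1) r by (cases t) auto
    obtain Y where Y: "Y ^ (r * t) \<le> N" "x - ln (real (r * t)) - ln 2 \<le> prime_recip_sum Y"
      using root_floor[OF t1 elim(3)] unfolding x_def .
    have rt: "\<beta> * x \<le> real (r * t)" "real (r * t) \<le> \<beta> * x + real r"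
      using t r by (simp_all add: field_simps)
    define P where "P = primes_upto Y - primes_upto w"
    have "\<exists>\<pi>. \<forall>j\<in>{..<t} \<times> {1..n}. q \<le> (\<Sum>p | p \<in> P \<and> \<pi> p = j. 1 / real p)"
    proof (rule balanced_colouring)
      show "finite P" by (simp add: P_def)
      show "1 / real p \<le> 1 / real w" if "p \<in> P" for p
        using that w by (auto simp: P_def primes_upto_def frac_le)
      have "real n * real t * (q + 1 / real w) \<le> prime_recip_sum Y - prime_recip_sum w"
      proof -
        have "real n * real t * (q + 1 / real w) = real (r * t) / \<alpha> + real n * real t / real w"
          using r \<alpha> by (simp add: q_def field_simps)
        also have "\<dots> \<le> (\<beta> * x + real r) / \<alpha> + real n * (\<beta> * x / real r + 1) / real w"
          using rt(2) t(2) \<alpha> by (intro add_mono divide_right_mono mult_left_mono) auto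
        also have "\<dots> = a * x + real r / \<alpha> + real n / real w"
          by (simp add: a_def add_divide_distrib algebra_simps)
        also have "\<dots> \<le> x - ln (\<beta> * x + real r) - ln 2 - prime_recip_sum w"
          using elim(1) by (simp add: K_def x_def)
        also have "\<dots> \<le> x - ln (real (r * t)) - ln 2 - prime_recip_sum w"
        proof -
          have "ln (real (r * t)) \<le> ln (\<beta> * x + real r)"
            using t1 by (intro ln_mono rt(2)) (simp only: of_nat_0_less_iff less_le_trans[OF zero_less_one])
          then show ?thesis by simp
        qed
        also have "\<dots> \<le> prime_recip_sum Y - prime_recip_sum w" using Y(2) by simp
        finally show ?thesis .
      qed
      also have "\<dots> \<le> (\<Sum>p\<in>P. 1 / real p)"
      proof -
        have "prime_recip_sum Y \<le> (\<Sum>p\<in>P \<union> primes_upto w. 1 / real p)"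
          unfolding prime_recip_sum_def by (intro sum_mono2) (auto simp: P_def)
        also have "\<dots> = (\<Sum>p\<in>P. 1 / real p) + prime_recip_sum w"
          unfolding prime_recip_sum_def by (intro sum.union_disjoint) (auto simp: P_def)
        finally show ?thesis by simp
      qed
      finally show "real (card ({..<t} \<times> {1..n})) * (q + 1 / real w) \<le> (\<Sum>p\<in>P. 1 / real p)"
        by (simp add: mult.commute)
    qed (use q in auto)
    then obtain \<pi> where \<pi>: "\<And>j. j \<in> {..<t} \<times> {1..n} \<Longrightarrow> q \<le> (\<Sum>p | p \<in> P \<and> \<pi> p = j. 1 / real p)"
      by blast
    have "ln (real N) powr \<beta> = exp (\<beta> * x)" using elim(3) by (simp add: powr_def x_def)
    also have "\<dots> \<le> exp (real (r * t))" using rt(1) by simp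
    also have "\<dots> = (M * q ^ r) ^ t"
      unfolding Mq by (simp add: power_mult[symmetric] flip: exp_of_nat_mult)
    also have "\<dots> \<le> lcm_max k N"
      unfolding M_def using q by (intro lcm_max_ge_power[OF k G free _ Y(1) _ \<pi>]) (auto simp: P_def)
    finally show ?case .
  qed
qed

lemma lcm_max_lower:
  fixes \<G> :: "nat set set"
  assumes k: "k \<ge> 3" and r: "1 \<le> r" "r \<le> n" and G: "\<G> \<subseteq> nsets {1..n} r"
    and free: "cosunflower_free k \<G>" and \<beta>: "\<beta> < rate n r \<G>"
  shows "eventually (\<lambda>N. \<beta> \<le> ln (lcm_max k N) / ln (ln (real N))) sequentially"
proof -
  have "eventually (\<lambda>N. ln (real N) powr \<beta> \<le> lcm_max k N) sequentially"
  proof (cases "\<beta> > 0")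
    case True
    then show ?thesis by (intro lcm_max_lower_pos[OF k r G free _ \<beta>])
  next
    \<comment> \<open>For \<beta> \<le> 0 the bound is trivial, since
      \<open>lcm_max k N \<ge> 1\<close>.\<close>
    case False
    have "eventually (\<lambda>N. ln (real N) \<ge> 1) sequentially" by real_asymp
    then show ?thesis
      using eventually_ge_at_top[of 1]
    proof eventually_elim
      case (elim N)
      have "ln (real N) powr \<beta> \<le> ln (real N) powr 0"
        using elim False by (intro powr_mono) auto
      also have "\<dots> \<le> 1" by simp
      also have "1 \<le> lcm_max k N"
        using elim(2) k by (intro lcm_max_ge_1) auto
      finally show ?case .
    qed
  qed
  moreover have "eventually (\<lambda>N. ln (ln (real N)) > 0) sequentially" by real_asymp
  moreover have "eventually (\<lambda>N. ln (real N) > 0) sequentially" by real_asymp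
  ultimately show ?thesis
  proof eventually_elim
    case (elim N)
    have "ln (ln (real N) powr \<beta>) \<le> ln (lcm_max k N)"
      using elim by (intro ln_mono) auto
    then show ?case using elim by (simp add: ln_powr pos_le_divide_eq)
  qed
qed

section \<open>The limit and the two claims\<close>

text \<open>The lower bounds from single families and the upper bound meet at the supremum. In
  particular the \<open>lim\<close> in \<open>lcm_exponent\<close> is a genuine limit.\<close>

theorem lcm_max_tendsto:
  assumes k: "k \<ge> 3"
  shows "(\<lambda>N. ln (lcm_max k N) / ln (ln (real N))) \<longlonglongrightarrow> Sup (rates k)"
proof (rule order_tendstoI)
  fix a assume "a < Sup (rates k)"
  then obtain x where x: "x \<in> rates k" "a < x"
    using less_cSup_iff[OF _ bdd_above_rates] rates_nonempty[of k] k by fastforce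
  then obtain n r and \<G> :: "nat set set" where G: "1 \<le> r" "r \<le> n" "\<G> \<subseteq> nsets {1..n} r"
    "cosunflower_free k \<G>" "x = rate n r \<G>"
    by (auto simp: rates_def)
  obtain \<beta> where \<beta>: "a < \<beta>" "\<beta> < rate n r \<G>"
    using x(2) dense unfolding G(5) by blast
  from lcm_max_lower[OF k G(1-4) \<beta>(2)]
  show "eventually (\<lambda>N. a < ln (lcm_max k N) / ln (ln (real N))) sequentially"
    by (rule eventually_mono) (use \<beta>(1) in simp)
qed (rule lcm_max_upper[OF k])

corollary lcm_exponent_eq_Sup: "k \<ge> 3 \<Longrightarrow> lcm_exponent k = Sup (rates k)"
  unfolding lcm_exponent_def by (rule limI[OF lcm_max_tendsto])

lemma lcm_max_ge_powr_rate:
  fixes \<G> :: "nat set set"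
  assumes k: "k \<ge> 3" and G: "1 \<le> r" "r \<le> n" "\<G> \<subseteq> nsets {1..n} r" "cosunflower_free k \<G>"
  shows "\<exists>g \<in> o(\<lambda>_. 1). eventually (\<lambda>N. ln (real N) powr (rate n r \<G> - g N) \<le> lcm_max k N) sequentially"
proof
  define \<alpha> where "\<alpha> = rate n r \<G>"
  \<comment> \<open>The deficit is truncated at 0, because the ratio may converge to a limit above
    \<open>\<alpha>\<close>; truncated, it tends to 0.\<close>
  define g where "g = (\<lambda>N. max 0 (\<alpha> - ln (lcm_max k N) / ln (ln (real N))))"
  have "g \<longlonglongrightarrow> 0"
  proof (rule order_tendstoI)
    fix a :: real assume "a < 0"
    then show "eventually (\<lambda>N. a < g N) sequentially" by (simp add: g_def less_max_iff_disj)
  next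
    fix a :: real assume a: "0 < a"
    then have "\<alpha> - a / 2 < rate n r \<G>" by (simp add: \<alpha>_def)
    from lcm_max_lower[OF k G this] show "eventually (\<lambda>N. g N < a) sequentially"
      by (rule eventually_mono) (use a in \<open>simp add: g_def\<close>)
  qed
  then show "g \<in> o(\<lambda>_. 1)" by (intro smalloI_tendsto) auto
  have "eventually (\<lambda>N. ln (ln (real N)) > 0) sequentially" by real_asymp
  moreover have "eventually (\<lambda>N. ln (real N) > 0) sequentially" by real_asymp
  ultimately show "eventually (\<lambda>N. ln (real N) powr (rate n r \<G> - g N) \<le> lcm_max k N) sequentially"
    using eventually_ge_at_top[of 1]
  proof eventually_elim
    case (elim N)
    have "rate n r \<G> - g N \<le> ln (lcm_max k N) / ln (ln (real N))"
      by (simp add: g_def \<alpha>_def)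
    then have "(rate n r \<G> - g N) * ln (ln (real N)) \<le> ln (lcm_max k N)"
      using elim(1) by (simp add: pos_le_divide_eq)
    then have "exp ((rate n r \<G> - g N) * ln (ln (real N))) \<le> exp (ln (lcm_max k N))"
      by simp
    also have "\<dots> = lcm_max k N" using lcm_max_ge_1[of k N] k elim(3) by simp
    finally show ?case using elim(2) by (simp add: powr_def)
  qed
qed

theorem corollary5p1:
  fixes k :: nat
  assumes "k \<ge> 3"
  shows
    "(\<forall>(n::nat) (r::nat) (M::nat) (G :: nat set set).
        1 \<le> r \<and> r \<le> n \<and> G \<subseteq> nsets {1..n} r \<and> cosunflower_free k G \<and> card G = M \<longrightarrow>
        (\<exists>g :: nat \<Rightarrow> real. g \<in> o(\<lambda>_. 1) \<and>
           (\<forall>\<^sub>F N in sequentially.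
              lcm_max k N \<ge>
                ln (real N) powr (real r / (exp 1 * real n) * real M powr (1 / real r) - g N))))
     \<and>
     (\<forall>\<epsilon>::real. \<epsilon> > 0 \<longrightarrow>
        (\<exists>(n::nat) (r::nat) (G :: nat set set).
           1 \<le> r \<and> r \<le> n \<and> G \<subseteq> nsets {1..n} r \<and> cosunflower_free k G \<and>
           real r / (exp 1 * real n) * real (card G) powr (1 / real r) > lcm_exponent k - \<epsilon>))"
proof (intro conjI allI impI)
  fix n r M :: nat and G :: "nat set set"
  assume "1 \<le> r \<and> r \<le> n \<and> G \<subseteq> nsets {1..n} r \<and> cosunflower_free k G \<and> card G = M"
  then show "\<exists>g :: nat \<Rightarrow> real. g \<in> o(\<lambda>_. 1) \<and> (\<forall>\<^sub>F N in sequentially.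
      lcm_max k N \<ge> ln (real N) powr (real r / (exp 1 * real n) * real M powr (1 / real r) - g N))"
    using lcm_max_ge_powr_rate[OF assms, of r n G] by (auto simp: rate_def)
next
  fix \<epsilon> :: real assume "\<epsilon> > 0"
  \<comment> \<open>As the exponent is the supremum of \<open>rates k\<close>, some member exceeds
    it minus \<epsilon> and supplies the triple.\<close>
  then have "lcm_exponent k - \<epsilon> < Sup (rates k)"
    using lcm_exponent_eq_Sup[OF assms] by simp
  then obtain x where "x \<in> rates k" "lcm_exponent k - \<epsilon> < x"
    using less_cSup_iff[OF _ bdd_above_rates] rates_nonempty[of k] assms by fastforce
  then show "\<exists>(n::nat) (r::nat) (G :: nat set set).
      1 \<le> r \<and> r \<le> n \<and> G \<subseteq> nsets {1..n} r \<and> cosunflower_free k G \<and>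
      real r / (exp 1 * real n) * real (card G) powr (1 / real r) > lcm_exponent k - \<epsilon>"
    by (auto simp: rates_def rate_def)
qed

end
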